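(* There is an absolute constant $K_2>0$ such that the following holds. Let $r=r(n)$ satisfy $r \geq K_2 (\log n/n)^{1/5}$ and let $G \in \mathcal{G}(n,r)$. Then $c(G) = 1$ with probability tending to $1$ as $n\to\infty$.
   Context: $\mathcal{G}(n,r)$ denotes the random geometric graph $G(x_1,\dots,x_n;r)$ where $x_1,\dots,x_n$ are chosen independently and uniformly at random from $[0,1]^2$, and $x_i,x_j$ ($i\ne j$) are adjacent iff $\|x_i-x_j\|\le r$. Game of cops and robbers on a finite graph: cops choose starting vertices, then the robber; players alternate turns, each agent moving to an adjacent vertex or staying put (cops move simultaneously; full information); cops win if some cop eventually occupies the robber's vertex. The cop number $c(G)$ is the minimum number of cops having a strategy that wins against every robber strategy. *)

theory Defs
  imports "HOL-Probability.Probability"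
begin

text \<open>A graph is given by a vertex set V and a symmetric adjacency relation adj.
  With k cops, cop positions are functions nat => 'a (only indices i < k matter).
  A cop strategy f maps the history (cop positions so far, robber positions so far)
  to the next cop positions; f [] [] is the initial placement.
  A robber strategy g maps the history (cop positions C_0..C_t, robber positions
  R_0..R_(t-1)) to the robber position R_t.\<close>

definition play_consistent ::
  "((nat \<Rightarrow> 'a) list \<Rightarrow> 'a list \<Rightarrow> (nat \<Rightarrow> 'a)) \<Rightarrow>
   ((nat \<Rightarrow> 'a) list \<Rightarrow> 'a list \<Rightarrow> 'a) \<Rightarrow>
   (nat \<Rightarrow> nat \<Rightarrow> 'a) \<Rightarrow> (nat \<Rightarrow> 'a) \<Rightarrow> bool" where
  "play_consistent f g C R \<longleftrightarrow>
     C 0 = f [] [] \<and>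
     (\<forall>t. R t = g (map C [0..<Suc t]) (map R [0..<t])) \<and>
     (\<forall>t. C (Suc t) = f (map C [0..<Suc t]) (map R [0..<Suc t]))"

definition cops_legal :: "'a set \<Rightarrow> ('a \<Rightarrow> 'a \<Rightarrow> bool) \<Rightarrow> nat \<Rightarrow> (nat \<Rightarrow> nat \<Rightarrow> 'a) \<Rightarrow> bool" where
  "cops_legal V adj k C \<longleftrightarrow>
     (\<forall>t. \<forall>i<k. C t i \<in> V \<and> (C (Suc t) i = C t i \<or> adj (C t i) (C (Suc t) i)))"

definition robber_legal :: "'a set \<Rightarrow> ('a \<Rightarrow> 'a \<Rightarrow> bool) \<Rightarrow> (nat \<Rightarrow> 'a) \<Rightarrow> bool" where
  "robber_legal V adj R \<longleftrightarrow>
     (\<forall>t. R t \<in> V \<and> (R (Suc t) = R t \<or> adj (R t) (R (Suc t))))"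

text \<open>Capture: some cop occupies the robber's vertex, either after the robber's move
  (C_t i = R_t) or after the cops' move (C_(t+1) i = R_t).\<close>
definition captured :: "nat \<Rightarrow> (nat \<Rightarrow> nat \<Rightarrow> 'a) \<Rightarrow> (nat \<Rightarrow> 'a) \<Rightarrow> bool" where
  "captured k C R \<longleftrightarrow> (\<exists>t. \<exists>i<k. C t i = R t \<or> C (Suc t) i = R t)"

definition cops_win :: "'a set \<Rightarrow> ('a \<Rightarrow> 'a \<Rightarrow> bool) \<Rightarrow> nat \<Rightarrow> bool" where
  "cops_win V adj k \<longleftrightarrow>
     (\<exists>f. \<forall>g C R. play_consistent f g C R \<longrightarrow>
        cops_legal V adj k C \<and> (robber_legal V adj R \<longrightarrow> captured k C R))"

definition cop_number :: "'a set \<Rightarrow> ('a \<Rightarrow> 'a \<Rightarrow> bool) \<Rightarrow> nat" where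
  "cop_number V adj = (LEAST k. cops_win V adj k)"

text \<open>G(x_1,...,x_n; r) with vertex set {0..<n}; points in R^2 = real \<times> real
  (whose dist is the Euclidean distance).\<close>
definition rgg_adj :: "nat \<Rightarrow> (nat \<Rightarrow> real \<times> real) \<Rightarrow> real \<Rightarrow> nat \<Rightarrow> nat \<Rightarrow> bool" where
  "rgg_adj n x r i j \<longleftrightarrow> i < n \<and> j < n \<and> i \<noteq> j \<and> dist (x i) (x j) \<le> r"

definition rgg_space :: "nat \<Rightarrow> (nat \<Rightarrow> real \<times> real) measure" where
  "rgg_space n = PiM {0..<n} (\<lambda>_. uniform_measure lborel (cbox (0,0) (1,1)))"

end

theory Submission
  imports Defs
begin

text \<open>
  Order the vertices by their distance to the centre c of the square. Let v be a vertex at distance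
  R \<ge> r/2 from c. Since every vertex w that is no farther from c than v lies in a disc with v on its
  boundary, a point u obtained from v by moving inwards by a distance of order \<^term>\<open>r\<^sup>2 / R\<close> and sideways by
  at most \<^term>\<open>r ^ 3 / 32\<close> is within r of all such w that are adjacent to v. The points u of this kind form a
  region of area at least \<^term>\<open>r ^ 5 / 256\<close>, so if \<^term>\<open>r ^ 5\<close> is at least a large multiple of \<^term>\<open>ln n / n\<close>, then with
  high probability each such v has a vertex in its region. Vertices closer than r/2 to c are
  dominated by the vertex closest to c. The graph is therefore dismantlable, and one cop wins by
  chasing the image of the robber under the successive retractions.
\<close>

section \<open>Cops and robber on graphs with a dismantling order\<close>

text \<open>No index lies below 0, so \<open>captured 0\<close> always fails and a single consistent
  play with a legal robber refutes a winning strategy. The robber that never leaves \<open>v\<close>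
  provides one.\<close>

lemma not_cops_win_0:
  assumes "v \<in> V"
  shows "\<not> cops_win V adj 0"
proof
  assume "cops_win V adj 0"
  then obtain f where f: "\<And>g C R. play_consistent f g C R \<Longrightarrow> robber_legal V adj R \<Longrightarrow> captured 0 C R"
    unfolding cops_win_def by blast
  \<comment> \<open>\<open>f\<close> reads the whole history, so the recursion builds the list
    \<open>H t\<close> of the first \<open>t\<close> cop positions instead of the positions
    themselves.\<close>
  define H where "H = rec_nat [] (\<lambda>t L. L @ [f L (replicate t v)])"
  have H0: "H 0 = []" and HS: "H (Suc t) = H t @ [f (H t) (replicate t v)]" for t
    by (simp_all add: H_def)
  define C where "C t = f (H t) (replicate t v)" for t
  have H: "map C [0..<t] = H t" for t
    by (induction t) (simp_all add: H0 HS C_def)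
  have "play_consistent f (\<lambda>_ _. v) C (\<lambda>_. v)"
    unfolding play_consistent_def H map_replicate_const by (simp add: C_def H0)
  moreover have "robber_legal V adj (\<lambda>_. v)"
    using assms by (simp add: robber_legal_def)
  ultimately show False
    using f by (fastforce simp: captured_def)
qed

text \<open>With N an upper bound of the rank h, \<open>shadow h \<phi> N j\<close> retracts onto the vertices of rank at most
  \<open>N - j\<close>. At time t the cop occupies the shadow of the robber at rank t; the extra rank that the
  target gains in each round costs nothing, because the parent of a vertex dominates it.\<close>

primrec shadow :: "('a \<Rightarrow> nat) \<Rightarrow> ('a \<Rightarrow> 'a) \<Rightarrow> nat \<Rightarrow> nat \<Rightarrow> 'a \<Rightarrow> 'a" where
  "shadow h \<phi> N 0 v = v"
| "shadow h \<phi> N (Suc j) v =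
     (if h (shadow h \<phi> N j v) < N - j then shadow h \<phi> N j v else \<phi> (shadow h \<phi> N j v))"

text \<open>Ties in \<open>h\<close> are allowed: all vertices of the current top rank retract onto
  their parents at once. For this, \<open>dominates\<close> also speaks of neighbours of equal rank;
  its case \<open>u = v\<close> says that \<open>v\<close> is near its own parent.\<close>

locale dismantling =
  fixes V :: "'a set" and adj :: "'a \<Rightarrow> 'a \<Rightarrow> bool" and h :: "'a \<Rightarrow> nat" and \<phi> :: "'a \<Rightarrow> 'a"
    and root :: 'a and N :: nat
  assumes root: "root \<in> V"
    and bound: "\<And>v. v \<in> V \<Longrightarrow> h v \<le> N"
    and sym: "\<And>u v. adj u v \<Longrightarrow> adj v u"
    and h_0: "\<And>v. v \<in> V \<Longrightarrow> h v = 0 \<Longrightarrow> v = root"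
    and parent: "\<And>v. v \<in> V \<Longrightarrow> h v > 0 \<Longrightarrow> \<phi> v \<in> V \<and> h (\<phi> v) < h v"
    and dominates: "\<And>u v. u \<in> V \<Longrightarrow> v \<in> V \<Longrightarrow> h v > 0 \<Longrightarrow> h u \<le> h v \<Longrightarrow>
      u = v \<or> adj u v \<Longrightarrow> u = \<phi> v \<or> adj u (\<phi> v)"
begin

abbreviation near :: "'a \<Rightarrow> 'a \<Rightarrow> bool" where
  "near u v \<equiv> u = v \<or> adj u v"

abbreviation shade :: "nat \<Rightarrow> 'a \<Rightarrow> 'a" where
  "shade \<equiv> shadow h \<phi> N"

lemma near_sym: "near u v \<Longrightarrow> near v u"
  using sym by blast

lemma shade_level:
  assumes "v \<in> V" "j \<le> N"
  shows "shade j v \<in> V \<and> h (shade j v) \<le> N - j"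
  using assms(2)
proof (induction j)
  case 0
  then show ?case using assms(1) bound by simp
next
  case (Suc j)
  then have *: "shade j v \<in> V" "h (shade j v) \<le> N - j" and "N - j > 0" by auto
  show ?case
  proof (cases "h (shade j v) < N - j")
    case True
    then show ?thesis using * by simp
  next
    case False
    with * \<open>N - j > 0\<close> parent[of "shade j v"]
    have "\<phi> (shade j v) \<in> V" "h (\<phi> (shade j v)) < N - j" by auto
    with False show ?thesis by auto
  qed
qed

text \<open>A vertex that is retracted has the top rank \<open>N - j\<close>, so the other one is a
  neighbour of no larger rank and stays near the parent. The offset of one stage is that of a cop's
  move.\<close>

lemma near_shade_Suc:
  assumes "v \<in> V" "w \<in> V" "Suc j \<le> N" "near (shade j v) (shade j w)"
  shows "near (shade (Suc j) v) (shade j w)"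
proof (cases "h (shade j v) < N - j")
  case True
  then show ?thesis using assms by simp
next
  case False
  have "h (shade j v) = N - j" "h (shade j w) \<le> N - j" "shade j v \<in> V" "shade j w \<in> V" "N - j > 0"
    using False shade_level[of v j] shade_level[of w j] assms by auto
  then have "near (shade j w) (\<phi> (shade j v))"
    using dominates[of "shade j w" "shade j v"] near_sym[OF assms(4)] by simp
  then show ?thesis using False near_sym by auto
qed

text \<open>The retraction is a homomorphism of reflexive graphs. The two vertices are retracted one
  after the other: when the second one leaves the top rank, the first is already below it, so
  \<open>dominates\<close> applies.\<close>

lemma near_shade:
  assumes "v \<in> V" "w \<in> V" "near v w" "j \<le> N"
  shows "near (shade j v) (shade j w)"
  using assms(4)
proof (induction j)
  case 0
  then show ?case using assms(3) by simp
next
  case (Suc j)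
  then have j: "j < N" and IH: "near (shade j v) (shade j w)" by auto
  note L = shade_level[OF assms(1), of j] shade_level[OF assms(2), of j]
    shade_level[OF assms(1) Suc.prems]
  have 1: "near (shade (Suc j) v) (shade j w)"
    using near_shade_Suc[OF assms(1,2) Suc.prems IH] .
  show ?case
  proof (cases "h (shade j w) < N - j")
    case True
    then show ?thesis using 1 by simp
  next
    case False
    have "h (shade (Suc j) v) \<le> h (shade j w)" "h (shade j w) > 0"
      using False L j by linarith+
    then have "near (shade (Suc j) v) (\<phi> (shade j w))"
      using dominates[of "shade (Suc j) v" "shade j w", OF _ _ _ _ 1] L less_imp_le[OF j] by presburger
    then show ?thesis using False by simp
  qed
qed

lemma near_shade_step:
  assumes "v \<in> V" "w \<in> V" "near v w"
  shows "near (shade (N - t) v) (shade (N - Suc t) w)"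
proof (cases "t < N")
  case True
  then have "N - t = Suc (N - Suc t)" "Suc (N - Suc t) \<le> N" "N - Suc t \<le> N" by simp_all
  then show ?thesis
    using near_shade_Suc[OF assms(1,2) _ near_shade[OF assms]] by metis
next
  \<comment> \<open>Now both truncated differences are 0, and \<open>shade 0\<close> is the
    identity.\<close>
  case False
  then show ?thesis using assms by simp
qed

lemma cops_win_1: "cops_win V adj 1"
proof -
  define target where "target Rs = shade (N - length Rs) (last Rs)" for Rs
  \<comment> \<open>Legality of the cops is demanded even against an illegal robber, so the cop
    stays put whenever the target is out of reach. When choosing \<open>C (Suc t)\<close> the cop
    has seen \<open>Suc t\<close> robber positions and hence aims at stage
    \<open>N - Suc t\<close>.\<close>
  define f :: "(nat \<Rightarrow> 'a) list \<Rightarrow> 'a list \<Rightarrow> nat \<Rightarrow> 'a" where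
    "f Cs Rs = (\<lambda>_. if Rs = [] then root
       else if target Rs \<in> V \<and> near (last Cs 0) (target Rs) then target Rs else last Cs 0)" for Cs Rs
  have "cops_legal V adj 1 C \<and> (robber_legal V adj R \<longrightarrow> captured 1 C R)"
    if "play_consistent f g C R" for g C R
  proof -
    have C0: "C 0 0 = root"
      using that by (simp add: play_consistent_def f_def)
    have CS: "C (Suc t) 0 = (if shade (N - Suc t) (R t) \<in> V \<and> near (C t 0) (shade (N - Suc t) (R t))
        then shade (N - Suc t) (R t) else C t 0)" for t
    proof -
      have "C (Suc t) = f (map C [0..<Suc t]) (map R [0..<Suc t])"
        using that unfolding play_consistent_def by blast
      then show ?thesis by (auto simp: f_def target_def)
    qed
    have in_V: "C t 0 \<in> V" for t
      by (induction t) (simp_all only: C0 CS root, auto)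
    have "cops_legal V adj 1 C"
      unfolding cops_legal_def using in_V CS by auto
    moreover have "captured 1 C R" if R: "robber_legal V adj R"
    proof -
      have RV: "R t \<in> V" and RR: "near (R t) (R (Suc t))" for t
        using R unfolding robber_legal_def by metis+
      have shade_V: "shade (N - t) (R k) \<in> V" for t k
        using shade_level[OF RV] by simp
      have follows: "C (Suc t) 0 = shade (N - Suc t) (R t)" for t
      proof (induction t)
        case 0
        \<comment> \<open>At stage \<open>N\<close> only rank 0 is left, so the cop starts on the
          shadow of any robber position.\<close>
        have "shade (N - 0) (R 0) = root"
          using shade_level[OF RV, of N 0] h_0 by simp
        then show ?case
          using CS[of 0] C0 near_shade_step[OF RV RV, of 0 0 0] shade_V by simp
      next
        case (Suc t)
        show ?case
          using CS[of "Suc t"] near_shade_step[OF RV RV RR, of "Suc t" t] shade_V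
          unfolding Suc.IH by presburger
      qed
      \<comment> \<open>At \<open>t = N\<close> the truncated stage \<open>N - Suc N\<close> is 0,
        so the cop stands on \<open>R N\<close> itself.\<close>
      show ?thesis
        unfolding captured_def using follows[of N] by auto
    qed
    ultimately show ?thesis by blast
  qed
  then show ?thesis unfolding cops_win_def by blast
qed

lemma cop_number_eq_1: "cop_number V adj = 1"
  unfolding cop_number_def
proof (rule Least_equality)
  show "cops_win V adj 1" by (rule cops_win_1)
  show "1 \<le> k" if "cops_win V adj k" for k
    using that not_cops_win_0[OF root] by (cases k) auto
qed

end

section \<open>Geometry of the dominating slivers\<close>

text \<open>With \<open>z = w - q\<close> and \<open>l = 1 - \<kappa>\<close>, the condition
  \<open>|w| \<le> |q|\<close> amounts to \<open>2 (q \<bullet> z) \<le> - |z|^2\<close>. Moving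
  from \<open>q\<close> towards the origin by \<open>l q\<close> therefore brings every such
  \<open>w\<close> within \<open>r (1 - 3 l / 8)\<close>. The gain \<open>3 r l / 8\<close> is at
  least \<open>3 r^3 / 64\<close>, which pays for the shift \<open>\<tau>\<close> along
  \<open>e\<close>.\<close>

lemma sliver_dominates:
  fixes q e w :: "'a::real_inner"
  assumes r: "0 < r" "r / 2 \<le> norm q" and q: "norm q \<le> 1" and e: "norm e = 1"
    and \<mu>: "\<mu> = r\<^sup>2 / (8 * (norm q)\<^sup>2)"
    and \<kappa>: "1 - 2 * \<mu> \<le> \<kappa>" "\<kappa> \<le> 1 - \<mu>" and \<tau>: "\<bar>\<tau>\<bar> \<le> r ^ 3 / 32"
    and u: "u = \<kappa> *\<^sub>R q + \<tau> *\<^sub>R e"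
  shows "norm u < norm q"
    and "norm w \<le> norm q \<Longrightarrow> norm (w - q) \<le> r \<Longrightarrow> norm (w - u) \<le> r"
proof -
  define R where "R = norm q"
  define l where "l = 1 - \<kappa>"
  have R: "0 < R" "r \<le> 2 * R" "R \<le> 1" using r q by (auto simp: R_def)
  then have R2: "0 < R\<^sup>2" "R\<^sup>2 \<le> 1" "R\<^sup>2 \<le> R" "r\<^sup>2 \<le> 4 * R\<^sup>2"
    using r power_mono[of r "2 * R" 2] power_le_one[of R 2]
    by (auto simp: power2_eq_square mult_left_le)
  have \<mu>': "8 * \<mu> * R\<^sup>2 = r\<^sup>2" using R2 by (simp add: \<mu> R_def)
  have \<mu>_pos: "0 < \<mu>" and \<mu>_le: "\<mu> \<le> 1/2" and \<mu>_ge: "r\<^sup>2 / 8 \<le> \<mu>"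
    using R2 r by (auto simp: \<mu> R_def[symmetric] field_simps)
  have l: "\<mu> \<le> l" "l \<le> 2 * \<mu>" "0 < l" "l \<le> 1" "r\<^sup>2 / 8 \<le> l"
    using \<kappa> \<mu>_le \<mu>_pos \<mu>_ge by (auto simp: l_def)
  \<comment> \<open>The upper bound \<open>2 \<mu>\<close> on the step enters here: it keeps the
    quadratic term \<open>l * (l * R^2)\<close> at most \<open>l r^2 / 4\<close>.\<close>
  have lR2: "l * R\<^sup>2 \<le> r\<^sup>2 / 4"
    using mult_right_mono[OF l(2), of "R\<^sup>2"] \<mu>' zero_le_power2[of R] by linarith
  \<comment> \<open>The radial move has length at least \<open>r^2 / 8\<close>, twice the bound
    \<open>r^2 / 16\<close> on the sideways shift, so the norm drops.\<close>
  have lR: "r\<^sup>2 / 8 \<le> l * R"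
  proof -
    have "r\<^sup>2 / 8 = \<mu> * R\<^sup>2" using \<mu>' by simp
    also have "\<dots> \<le> l * R" using l \<mu>_pos R2 by (intro mult_mono) auto
    finally show ?thesis .
  qed
  have "r ^ 3 = r\<^sup>2 * r" by (simp add: power2_eq_square power3_eq_cube)
  also have "\<dots> \<le> r\<^sup>2 * 2" using R by (intro mult_left_mono) auto
  finally have r3: "r ^ 3 / 32 \<le> r\<^sup>2 / 16" by simp
  have "norm u \<le> norm (\<kappa> *\<^sub>R q) + norm (\<tau> *\<^sub>R e)"
    unfolding u by (rule norm_triangle_ineq)
  also have "\<dots> = \<kappa> * R + \<bar>\<tau>\<bar>" using l e by (simp add: R_def l_def)
  also have "\<dots> < R"
  proof -
    have "\<kappa> * R = R - l * R" by (simp add: l_def algebra_simps)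
    moreover have "0 < r\<^sup>2" using r by simp
    ultimately show ?thesis using lR r3 \<tau> by linarith
  qed
  finally show "norm u < norm q" by (simp add: R_def)
  assume w: "norm w \<le> norm q" "norm (w - q) \<le> r"
  define z where "z = w - q"
  have "(norm w)\<^sup>2 \<le> R\<^sup>2" using w by (simp add: R_def power_mono)
  moreover have "(norm w)\<^sup>2 = R\<^sup>2 + 2 * (q \<bullet> z) + (norm z)\<^sup>2"
    unfolding z_def R_def power2_norm_eq_inner by (simp add: algebra_simps inner_commute)
  ultimately have qz: "2 * (q \<bullet> z) \<le> - (norm z)\<^sup>2" by simp
  have z2: "(norm z)\<^sup>2 \<le> r\<^sup>2" using w by (simp add: z_def power_mono)
  have "(norm (z + l *\<^sub>R q))\<^sup>2 = (norm z)\<^sup>2 + l * (2 * (q \<bullet> z)) + l * (l * R\<^sup>2)"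
    unfolding R_def power2_norm_eq_inner by (simp add: algebra_simps inner_commute)
  also have "\<dots> \<le> (norm z)\<^sup>2 + l * (- (norm z)\<^sup>2) + l * (r\<^sup>2 / 4)"
    using qz lR2 l by (intro add_mono mult_left_mono) auto
  also have "\<dots> = (1 - l) * (norm z)\<^sup>2 + l * (r\<^sup>2 / 4)" by (simp add: algebra_simps)
  also have "\<dots> \<le> (1 - l) * r\<^sup>2 + l * (r\<^sup>2 / 4)"
    using z2 l by (intro add_mono mult_left_mono) auto
  also have "\<dots> = r\<^sup>2 * (1 - 3 * l / 4)" by (simp add: algebra_simps)
  \<comment> \<open>This is \<open>1 - 2 x \<le> (1 - x)^2\<close> for \<open>x = 3 l / 8\<close>;
    it turns the bound into a square, so that roots can be taken.\<close>
  also have "\<dots> \<le> r\<^sup>2 * (1 - 3 * l / 8)\<^sup>2"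
    by (intro mult_left_mono) (auto simp: power2_eq_square algebra_simps)
  also have "\<dots> = (r * (1 - 3 * l / 8))\<^sup>2" by (simp add: power_mult_distrib)
  finally have "(norm (z + l *\<^sub>R q))\<^sup>2 \<le> (r * (1 - 3 * l / 8))\<^sup>2" .
  then have A: "norm (z + l *\<^sub>R q) \<le> r * (1 - 3 * l / 8)"
    by (rule power2_le_imp_le) (use r l in simp)
  have "w - u = (z + l *\<^sub>R q) - \<tau> *\<^sub>R e"
    by (simp add: z_def l_def u algebra_simps)
  then have "norm (w - u) \<le> norm (z + l *\<^sub>R q) + norm (\<tau> *\<^sub>R e)"
    by (metis norm_triangle_ineq4)
  also have "\<dots> \<le> r * (1 - 3 * l / 8) + r ^ 3 / 32"
    using A \<tau> e by simp
  also have "\<dots> \<le> r"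
  proof -
    have "r * (r\<^sup>2 / 8) \<le> r * l" using l r by (intro mult_left_mono) auto
    moreover have "r * (r\<^sup>2 / 8) = r ^ 3 / 8" by (simp add: power2_eq_square power3_eq_cube)
    moreover have "0 < r ^ 3" using r by simp
    moreover have "r * (1 - 3 * l / 8) = r - 3 / 8 * (r * l)" by (simp add: algebra_simps)
    ultimately show ?thesis by linarith
  qed
  finally show "norm (w - u) \<le> r" .
qed

text \<open>In coordinates centred at the middle of the square, \<open>sliver r q\<close> consists of the points
  \<open>\<kappa> q + (0, \<tau>)\<close> with \<open>1 - 2 \<mu> \<le> \<kappa> \<le> 1 - \<mu>\<close>, \<open>\<mu> = r\<^sup>2 / (8 |q|\<^sup>2)\<close> and \<open>|\<tau>| \<le> r\<^sup>3 / 32\<close>. Displacing along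
  a coordinate axis instead of orthogonally to q makes its area an iterated integral; the axis is
  the one of the smaller coordinate of q, so that the displacement stays transversal to q.\<close>

definition sliver :: "real \<Rightarrow> real \<times> real \<Rightarrow> real \<times> real \<Rightarrow> bool" where
  "sliver r q p \<longleftrightarrow>
     1 - 2 * (r\<^sup>2 / (8 * (norm q)\<^sup>2)) \<le> fst p / fst q \<and> fst p / fst q \<le> 1 - r\<^sup>2 / (8 * (norm q)\<^sup>2) \<and>
     \<bar>snd p - (fst p / fst q) * snd q\<bar> \<le> r ^ 3 / 32"

definition region :: "real \<Rightarrow> real \<times> real \<Rightarrow> real \<times> real \<Rightarrow> bool" where
  "region r q p \<longleftrightarrow> (if \<bar>snd q\<bar> \<le> \<bar>fst q\<bar> then sliver r q p else sliver r (prod.swap q) (prod.swap p))"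

lemma norm_prod_swap: "norm (prod.swap q) = norm (q :: real \<times> real)"
  by (cases q) (simp add: norm_Pair add.commute)

lemma sliver_decompose:
  assumes "fst q \<noteq> 0"
  shows "p = (fst p / fst q) *\<^sub>R q + (snd p - (fst p / fst q) * snd q) *\<^sub>R ((0, 1) :: real \<times> real)"
  using assms by (cases p; cases q) simp

lemma sliver_parent:
  fixes q p w :: "real \<times> real"
  assumes "sliver r q p" "fst q \<noteq> 0" "0 < r" "r / 2 \<le> norm q" "norm q \<le> 1"
  shows "norm p < norm q"
    and "norm w \<le> norm q \<Longrightarrow> norm (w - q) \<le> r \<Longrightarrow> norm (w - p) \<le> r"
  using sliver_dominates[OF assms(3,4,5) _ refl _ _ _ sliver_decompose[OF assms(2)], of p] assms(1)
  by (simp_all add: sliver_def norm_Pair)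

text \<open>Swapping the coordinates is an isometry, which reduces both cases to slivers. A vertex
  in the region of \<open>q\<close> can thus serve as the parent of \<open>q\<close>.\<close>

lemma region_parent:
  fixes q p w :: "real \<times> real"
  assumes "region r q p" "0 < r" "r / 2 \<le> norm q" "norm q \<le> 1"
  shows "norm p < norm q"
    and "norm w \<le> norm q \<Longrightarrow> norm (w - q) \<le> r \<Longrightarrow> norm (w - p) \<le> r"
proof -
  have swap_diff: "prod.swap a - prod.swap b = prod.swap (a - b)" for a b :: "real \<times> real"
    by (cases a; cases b) simp
  have q0: "q \<noteq> 0" using assms by auto
  have "norm p < norm q \<and> (norm w \<le> norm q \<longrightarrow> norm (w - q) \<le> r \<longrightarrow> norm (w - p) \<le> r)"
  proof (cases "\<bar>snd q\<bar> \<le> \<bar>fst q\<bar>")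
    case True
    then have "fst q \<noteq> 0" using q0 by (auto simp: prod_eq_iff)
    then show ?thesis
      using sliver_parent(1)[of r q p] sliver_parent(2)[of r q p w] assms True by (simp add: region_def)
  next
    case False
    then show ?thesis
      using sliver_parent(1)[of r "prod.swap q" "prod.swap p"]
        sliver_parent(2)[of r "prod.swap q" "prod.swap p" "prod.swap w"] assms
      by (auto simp: region_def norm_prod_swap swap_diff)
  qed
  then show "norm p < norm q" "norm w \<le> norm q \<Longrightarrow> norm (w - q) \<le> r \<Longrightarrow> norm (w - p) \<le> r"
    by auto
qed

text \<open>Scaling by at most \<open>1 - \<mu>\<close> leaves a margin of
  \<open>\<mu> |fst q|\<close> in both coordinates, as \<open>fst q\<close> is the larger one, and
  the shift \<open>r^3 / 32\<close> of the second coordinate fits into it. The sliver thus stays in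
  the max-norm ball around the origin through \<open>q\<close>.\<close>

lemma sliver_bounds:
  fixes q p :: "real \<times> real"
  assumes "sliver r q p" "\<bar>snd q\<bar> \<le> \<bar>fst q\<bar>" "0 < r" "r / 2 \<le> norm q" "norm q \<le> 1"
  shows "\<bar>fst p\<bar> \<le> \<bar>fst q\<bar>" "\<bar>snd p\<bar> \<le> \<bar>fst q\<bar>"
proof -
  define R where "R = norm q"
  define \<mu> where "\<mu> = r\<^sup>2 / (8 * R\<^sup>2)"
  define k where "k = fst p / fst q"
  have q0: "fst q \<noteq> 0" using assms by (auto simp: norm_prod_def)
  have R: "0 < R" "r \<le> 2 * R" "R \<le> 1" using assms by (auto simp: R_def)
  have r2: "r\<^sup>2 \<le> 4 * R\<^sup>2"
    using assms R power_mono[of r "2 * R" 2] by simp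
  have \<mu>: "0 < \<mu>" "\<mu> \<le> 1/2" "8 * \<mu> * R\<^sup>2 = r\<^sup>2"
    using R r2 assms by (auto simp: \<mu>_def field_simps)
  have k: "0 \<le> k" "k \<le> 1 - \<mu>" "\<bar>snd p - k * snd q\<bar> \<le> r ^ 3 / 32"
    using assms(1) \<mu> by (auto simp: sliver_def \<mu>_def R_def k_def)
  have "fst p = k * fst q" using q0 by (simp add: k_def)
  then show "\<bar>fst p\<bar> \<le> \<bar>fst q\<bar>"
    using k \<mu> by (simp add: abs_mult mult_left_le_one_le)
  have "R \<le> \<bar>fst q\<bar> + \<bar>snd q\<bar>"
    unfolding R_def using norm_Pair_le[of "fst q" "snd q"] by simp
  then have Rq: "R / 2 \<le> \<bar>fst q\<bar>" using assms by simp
  have "r ^ 3 = r\<^sup>2 * r" by (simp add: power2_eq_square power3_eq_cube)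
  also have "\<dots> \<le> r\<^sup>2 * 2" using R by (intro mult_left_mono) auto
  finally have "r ^ 3 / 32 \<le> r\<^sup>2 / 16" by simp
  also have "\<dots> = \<mu> * (R * R / 2)" using \<mu>(3) by (simp add: power2_eq_square)
  also have "\<dots> \<le> \<mu> * (R / 2)" using \<mu> R by (intro mult_left_mono) (auto simp: mult_left_le)
  also have "\<dots> \<le> \<mu> * \<bar>fst q\<bar>" using \<mu> Rq by (intro mult_left_mono) auto
  finally have t: "r ^ 3 / 32 \<le> \<mu> * \<bar>fst q\<bar>" .
  have "\<bar>snd p\<bar> \<le> \<bar>k * snd q\<bar> + r ^ 3 / 32" using k by linarith
  also have "\<bar>k * snd q\<bar> \<le> (1 - \<mu>) * \<bar>fst q\<bar>"
    unfolding abs_mult using k assms(2) \<mu> by (intro mult_mono) auto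
  finally show "\<bar>snd p\<bar> \<le> \<bar>fst q\<bar>" using t by (simp add: algebra_simps)
qed

lemma region_max_le:
  fixes q p :: "real \<times> real"
  assumes "region r q p" "0 < r" "r / 2 \<le> norm q" "norm q \<le> 1"
  shows "\<bar>fst p\<bar> \<le> max \<bar>fst q\<bar> \<bar>snd q\<bar>" "\<bar>snd p\<bar> \<le> max \<bar>fst q\<bar> \<bar>snd q\<bar>"
proof -
  have "\<bar>fst p\<bar> \<le> max \<bar>fst q\<bar> \<bar>snd q\<bar> \<and> \<bar>snd p\<bar> \<le> max \<bar>fst q\<bar> \<bar>snd q\<bar>"
  proof (cases "\<bar>snd q\<bar> \<le> \<bar>fst q\<bar>")
    case True
    then have "sliver r q p" using assms(1) by (simp add: region_def)
    from sliver_bounds[OF this True assms(2-4)] show ?thesis by linarith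
  next
    case False
    then have "sliver r (prod.swap q) (prod.swap p)" using assms(1) by (simp add: region_def)
    from sliver_bounds[OF this _ assms(2)] False assms(3,4) show ?thesis
      by (simp add: norm_prod_swap)
  qed
  then show "\<bar>fst p\<bar> \<le> max \<bar>fst q\<bar> \<bar>snd q\<bar>" "\<bar>snd p\<bar> \<le> max \<bar>fst q\<bar> \<bar>snd q\<bar>"
    by blast+
qed

section \<open>Centred coordinates of the unit square and measurability\<close>

abbreviation centre :: "real \<times> real" where
  "centre \<equiv> (1/2, 1/2)"

abbreviation unit_square :: "(real \<times> real) set" where
  "unit_square \<equiv> cbox (0, 0) (1, 1)"

lemma mem_unit_square: "y \<in> unit_square \<longleftrightarrow> \<bar>fst (y - centre)\<bar> \<le> 1/2 \<and> \<bar>snd (y - centre)\<bar> \<le> 1/2"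
  by (cases y) (auto simp: cbox_Pair_eq abs_if split: if_splits)

lemma norm_le_1_unit_square:
  assumes "y \<in> unit_square"
  shows "norm (y - centre) \<le> 1"
  using assms norm_Pair_le[of "fst (y - centre)" "snd (y - centre)"]
  unfolding mem_unit_square prod.collapse real_norm_def by linarith

text \<open>The square is a max-norm ball about its centre, so a region cannot leave it, not even at
  a corner, and its whole area counts as probability.\<close>

lemma region_subset_unit_square:
  assumes "y \<in> unit_square" "0 < r" "r / 2 \<le> norm (y - centre)" "region r (y - centre) (u - centre)"
  shows "u \<in> unit_square"
  using region_max_le[OF assms(4,2,3) norm_le_1_unit_square[OF assms(1)]] assms(1)
  unfolding mem_unit_square by linarith

lemma sliver_measurable [measurable]:
  fixes a b c d :: "'a \<Rightarrow> real"
  assumes [measurable]: "a \<in> borel_measurable M" "b \<in> borel_measurable M"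
    "c \<in> borel_measurable M" "d \<in> borel_measurable M"
  shows "Measurable.pred M (\<lambda>z. sliver r (a z, b z) (c z, d z))"
  unfolding sliver_def norm_Pair fst_conv snd_conv by measurable

text \<open>Measurability is joint in both points because the region is attached to a random
  vertex.\<close>

lemma region_measurable [measurable]:
  "Measurable.pred (borel \<Otimes>\<^sub>M borel) (\<lambda>z. region r (fst z - centre) (snd z - centre))"
proof -
  \<comment> \<open>The pair type carries \<open>borel\<close> here, not a product algebra, so the
    projections are measurable by continuity.\<close>
  have [measurable]: "(\<lambda>z. fst (f z)) \<in> borel_measurable M" "(\<lambda>z. snd (f z)) \<in> borel_measurable M"
    if "f \<in> M \<rightarrow>\<^sub>M borel" for f :: "'a \<Rightarrow> real \<times> real" and M
    using measurable_compose[OF that borel_measurable_continuous_onI[OF continuous_on_fst[OF continuous_on_id]]]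
      measurable_compose[OF that borel_measurable_continuous_onI[OF continuous_on_snd[OF continuous_on_id]]]
    by simp_all
  have eq: "region r (y - centre) (u - centre) \<longleftrightarrow>
    (if \<bar>snd y - 1/2\<bar> \<le> \<bar>fst y - 1/2\<bar>
     then sliver r (fst y - 1/2, snd y - 1/2) (fst u - 1/2, snd u - 1/2)
     else sliver r (snd y - 1/2, fst y - 1/2) (snd u - 1/2, fst u - 1/2))" for y u
    by (cases y; cases u) (simp add: region_def)
  show ?thesis
    unfolding eq by measurable
qed

lemma sets_region: "{u. region r (y - centre) (u - centre)} \<in> sets borel"
proof -
  have "(\<lambda>u. (y, u)) \<in> borel \<rightarrow>\<^sub>M borel \<Otimes>\<^sub>M borel" by simp
  from measurable_compose[OF this region_measurable] show ?thesis
    by (simp add: pred_def)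
qed

section \<open>From slivers to a dismantling of the geometric graph\<close>

text \<open>Vertices closer than \<open>r / 2\<close> to the centre are pairwise within
  \<open>r\<close>, so \<open>root\<close> is a parent for all the others among them; any other
  vertex takes its parent from its region.\<close>

lemma rgg_cop_number_eq_1:
  fixes x :: "nat \<Rightarrow> real \<times> real"
  assumes "0 < n" "0 < r" and x: "\<And>i. i < n \<Longrightarrow> x i \<in> unit_square"
    and region: "\<And>i. i < n \<Longrightarrow> norm (x i - centre) < r / 2 \<or>
      (\<exists>j<n. region r (x i - centre) (x j - centre))"
  shows "cop_number {0..<n} (rgg_adj n x r) = 1"
proof -
  define \<rho> where "\<rho> i = norm (x i - centre)" for i
  obtain root where root: "root < n" "\<And>j. j < n \<Longrightarrow> \<rho> root \<le> \<rho> j"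
    using ex_min_if_finite[of "\<rho> ` {0..<n}"] \<open>0 < n\<close> by (fastforce simp: not_less)
  have "\<forall>i. \<exists>j. i < n \<longrightarrow> j < n \<and> (if \<rho> i < r / 2 then j = root else
      region r (x i - centre) (x j - centre))"
    using region root(1) unfolding \<rho>_def by metis
  then obtain \<phi> where \<phi>: "\<And>i. i < n \<Longrightarrow> \<phi> i < n \<and> (if \<rho> i < r / 2 then \<phi> i = root else
      region r (x i - centre) (x (\<phi> i) - centre))"
    by metis
  \<comment> \<open>\<open>Suc\<close> keeps vertices as close to the centre as \<open>root\<close>
    off rank 0, which must single out \<open>root\<close>. Apart from that, ties in distance are
    ties in rank.\<close>
  define h where "h i = (if i = root then 0 else Suc (card {k \<in> {0..<n}. \<rho> k < \<rho> i}))" for i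
  have card_less: "card {k \<in> {0..<n}. \<rho> k < \<rho> i} < card {k \<in> {0..<n}. \<rho> k < \<rho> j}"
    if "\<rho> i < \<rho> j" "i < n" for i j
    using that by (intro psubset_card_mono) auto
  have \<rho>_le: "\<rho> i \<le> \<rho> j" if "h i \<le> h j" "i < n" "j < n" for i j
    using that card_less[of j i] root by (force simp: h_def not_less split: if_splits)
  have near: "(i = j \<or> rgg_adj n x r i j) \<longleftrightarrow> dist (x i) (x j) \<le> r" if "i < n" "j < n" for i j
    using that \<open>0 < r\<close> by (auto simp: rgg_adj_def)
  have diff: "norm (x i - centre - (x j - centre)) = dist (x i) (x j)" for i j
    by (simp add: dist_norm)
  have far: "\<rho> (\<phi> i) < \<rho> i \<and>
      (\<forall>j. \<rho> j \<le> \<rho> i \<longrightarrow> dist (x j) (x i) \<le> r \<longrightarrow> dist (x j) (x (\<phi> i)) \<le> r)"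
    if "i < n" "\<not> \<rho> i < r / 2" for i
  proof -
    have "region r (x i - centre) (x (\<phi> i) - centre)" "r / 2 \<le> norm (x i - centre)"
      using \<phi>[OF that(1)] that(2) by (auto simp: \<rho>_def)
    note parent = region_parent[OF this(1) \<open>0 < r\<close> this(2) norm_le_1_unit_square[OF x[OF that(1)]]]
    show ?thesis
      using parent(1) parent(2)[of "x j - centre" for j] unfolding diff \<rho>_def by blast
  qed
  have "dismantling {0..<n} (rgg_adj n x r) h \<phi> root (Suc n)"
  proof
    show "root \<in> {0..<n}" using root by simp
    show "h v \<le> Suc n" for v
    proof -
      have "card {k \<in> {0..<n}. \<rho> k < \<rho> v} \<le> card {0..<n}" by (intro card_mono) auto
      then show ?thesis by (simp add: h_def)
    qed
    show "rgg_adj n x r v u" if "rgg_adj n x r u v" for u v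
      using that by (auto simp: rgg_adj_def dist_commute)
    show "v = root" if "h v = 0" for v
      using that by (simp add: h_def split: if_splits)
    show "\<phi> v \<in> {0..<n} \<and> h (\<phi> v) < h v" if "v \<in> {0..<n}" "h v > 0" for v
      using that \<phi>[of v] far[of v] card_less[of "\<phi> v" v]
      by (auto simp: h_def split: if_splits)
    show "u = \<phi> v \<or> rgg_adj n x r u (\<phi> v)"
      if "u \<in> {0..<n}" "v \<in> {0..<n}" "h v > 0" "h u \<le> h v" "u = v \<or> rgg_adj n x r u v" for u v
    proof -
      have uv: "u < n" "v < n" "\<rho> u \<le> \<rho> v" "dist (x u) (x v) \<le> r"
        using that \<rho>_le near by auto
      have "dist (x u) (x (\<phi> v)) \<le> r"
      proof (cases "\<rho> v < r / 2")
        case True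
        then have "\<phi> v = root" "\<rho> u < r / 2" "\<rho> root < r / 2"
          using \<phi> uv root(2)[of v] by auto
        then show ?thesis
          using norm_triangle_ineq4[of "x u - centre" "x root - centre"]
          unfolding diff \<rho>_def by simp
      next
        case False
        then show ?thesis using far uv by blast
      qed
      then show ?thesis using near \<phi> uv by blast
    qed
  qed
  then show ?thesis by (rule dismantling.cop_number_eq_1)
qed

section \<open>Area of the slivers\<close>

text \<open>By Fubini, as each nonempty section is an interval of length \<open>2 * t\<close>. Both
  orders of the coordinates occur, one for each case of \<open>region\<close>.\<close>

lemma emeasure_strip:
  fixes lo hi t :: real and g :: "real \<Rightarrow> real"
  assumes [measurable]: "g \<in> borel_measurable borel" and "lo \<le> hi" "0 \<le> t"
  shows "emeasure lborel {u. fst u \<in> {lo..hi} \<and> snd u \<in> {g (fst u) - t..g (fst u) + t}} = ennreal ((hi - lo) * (2 * t))"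
      (is "emeasure _ ?A = _")
    and "emeasure lborel {u. snd u \<in> {lo..hi} \<and> fst u \<in> {g (snd u) - t..g (snd u) + t}} = ennreal ((hi - lo) * (2 * t))"
      (is "emeasure _ ?B = _")
proof -
  have A: "?A \<in> sets (lborel \<Otimes>\<^sub>M lborel)" and B: "?B \<in> sets (lborel \<Otimes>\<^sub>M lborel)"
  proof -
    have "Measurable.pred (borel \<Otimes>\<^sub>M borel) (\<lambda>u. lo \<le> fst u \<and> fst u \<le> hi \<and>
        g (fst u) - t \<le> snd u \<and> snd u \<le> g (fst u) + t)"
      "Measurable.pred (borel \<Otimes>\<^sub>M borel) (\<lambda>u. lo \<le> snd u \<and> snd u \<le> hi \<and>
        g (snd u) - t \<le> fst u \<and> fst u \<le> g (snd u) + t)"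
      by measurable
    moreover have "sets (lborel \<Otimes>\<^sub>M lborel) = sets (borel \<Otimes>\<^sub>M borel :: (real \<times> real) measure)"
      by (intro sets_pair_measure_cong) simp_all
    ultimately show "?A \<in> sets (lborel \<Otimes>\<^sub>M lborel)" "?B \<in> sets (lborel \<Otimes>\<^sub>M lborel)"
      by (simp_all add: pred_def space_pair_measure)
  qed
  have int: "(\<integral>\<^sup>+x. ennreal (2 * t) * indicator {lo..hi} x \<partial>lborel) = ennreal ((hi - lo) * (2 * t))"
    using assms by (subst nn_integral_cmult_indicator) (simp_all add: ennreal_mult'[symmetric] mult.commute)
  have "emeasure lborel (Pair x -` ?A) = ennreal (2 * t) * indicator {lo..hi} x" for x
  proof -
    have "Pair x -` ?A = (if x \<in> {lo..hi} then {g x - t..g x + t} else {})" by auto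
    then show ?thesis using \<open>0 \<le> t\<close> by (simp add: indicator_def)
  qed
  then show "emeasure lborel ?A = ennreal ((hi - lo) * (2 * t))"
    unfolding lborel_prod[symmetric] lborel.emeasure_pair_measure_alt[OF A] by (simp only: int)
  have "emeasure lborel ((\<lambda>y. (y, x)) -` ?B) = ennreal (2 * t) * indicator {lo..hi} x" for x
  proof -
    have "(\<lambda>y. (y, x)) -` ?B = (if x \<in> {lo..hi} then {g x - t..g x + t} else {})" by auto
    then show ?thesis using \<open>0 \<le> t\<close> by (simp add: indicator_def)
  qed
  then show "emeasure lborel ?B = ennreal ((hi - lo) * (2 * t))"
    unfolding lborel_prod[symmetric] lborel_pair.emeasure_pair_measure_alt2[OF B] by (simp only: int)
qed

text \<open>The width is \<open>\<mu> |fst q|\<close>, at least \<open>r^2 / 16\<close> because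
  \<open>fst q\<close> is the larger coordinate and \<open>\<mu> |q|^2 = r^2 / 8\<close> with
  \<open>|q| \<le> 1\<close>. The height is \<open>r^3 / 16\<close>.\<close>

lemma sliver_strip:
  fixes q :: "real \<times> real"
  assumes "\<bar>snd q\<bar> \<le> \<bar>fst q\<bar>" "0 < r" "r / 2 \<le> norm q" "norm q \<le> 1"
  obtains lo hi where "lo \<le> hi" "r ^ 5 / 256 \<le> (hi - lo) * (2 * (r ^ 3 / 32))"
    "\<And>p. fst p \<in> {lo..hi} \<Longrightarrow>
      snd p \<in> {fst p / fst q * snd q - r ^ 3 / 32..fst p / fst q * snd q + r ^ 3 / 32} \<Longrightarrow> sliver r q p"
proof -
  define R where "R = norm q"
  define \<mu> where "\<mu> = r\<^sup>2 / (8 * R\<^sup>2)"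
  \<comment> \<open>\<open>fst q\<close> may be negative, which exchanges the endpoints.\<close>
  define lo where "lo = min (fst q * (1 - 2 * \<mu>)) (fst q * (1 - \<mu>))"
  define hi where "hi = max (fst q * (1 - 2 * \<mu>)) (fst q * (1 - \<mu>))"
  have q0: "fst q \<noteq> 0" using assms by (auto simp: norm_prod_def)
  have R: "0 < R" "r \<le> 2 * R" "R \<le> 1" using assms by (auto simp: R_def)
  have \<mu>: "0 < \<mu>" "8 * \<mu> * R\<^sup>2 = r\<^sup>2"
    using R assms by (auto simp: \<mu>_def field_simps)
  have "R \<le> \<bar>fst q\<bar> + \<bar>snd q\<bar>"
    unfolding R_def using norm_Pair_le[of "fst q" "snd q"] by simp
  then have Rq: "R / 2 \<le> \<bar>fst q\<bar>" using assms by simp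
  have "hi - lo = \<bar>fst q * (1 - \<mu>) - fst q * (1 - 2 * \<mu>)\<bar>"
    by (simp add: hi_def lo_def)
  also have "fst q * (1 - \<mu>) - fst q * (1 - 2 * \<mu>) = fst q * \<mu>"
    by (simp add: algebra_simps)
  finally have width: "hi - lo = \<bar>fst q\<bar> * \<mu>" using \<mu> by (simp add: abs_mult)
  have "r\<^sup>2 / 16 = R * R / 2 * \<mu>" using \<mu>(2) by (simp add: power2_eq_square algebra_simps)
  also have "\<dots> \<le> R / 2 * \<mu>" using \<mu> R by (intro mult_right_mono) (auto simp: mult_left_le)
  also have "\<dots> \<le> \<bar>fst q\<bar> * \<mu>" using \<mu> Rq by (intro mult_right_mono) auto
  finally have "r\<^sup>2 / 16 * (2 * (r ^ 3 / 32)) \<le> (hi - lo) * (2 * (r ^ 3 / 32))"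
    unfolding width using assms by (intro mult_right_mono) auto
  moreover have "r\<^sup>2 / 16 * (2 * (r ^ 3 / 32)) = r ^ 5 / 256"
    by (simp add: power2_eq_square power3_eq_cube power_def numeral_eq_Suc)
  moreover have "sliver r q p" if "fst p \<in> {lo..hi}"
      "snd p \<in> {fst p / fst q * snd q - r ^ 3 / 32..fst p / fst q * snd q + r ^ 3 / 32}" for p
  proof -
    have "1 - 2 * \<mu> \<le> fst p / fst q \<and> fst p / fst q \<le> 1 - \<mu>"
    proof (cases "fst q > 0")
      case True
      then have "fst q * (1 - 2 * \<mu>) \<le> fst q * (1 - \<mu>)" using \<mu> by (intro mult_left_mono) auto
      then show ?thesis using that(1) True by (simp add: lo_def hi_def field_simps)
    next
      case False
      then have "fst q < 0" using q0 by simp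
      then have "fst q * (1 - \<mu>) \<le> fst q * (1 - 2 * \<mu>)" using \<mu> by (intro mult_left_mono_neg) auto
      then show ?thesis using that(1) \<open>fst q < 0\<close> by (simp add: lo_def hi_def field_simps)
    qed
    moreover have "\<bar>snd p - fst p / fst q * snd q\<bar> \<le> r ^ 3 / 32"
      using that(2) unfolding atLeastAtMost_iff by linarith
    ultimately show ?thesis unfolding sliver_def \<mu>_def R_def by blast
  qed
  moreover have "lo \<le> hi" by (simp add: lo_def hi_def)
  ultimately show thesis using that by metis
qed

lemma emeasure_region:
  assumes y: "y \<in> unit_square" and r: "0 < r" "r / 2 \<le> norm (y - centre)"
  shows "ennreal (r ^ 5 / 256) \<le> emeasure lborel {u. region r (y - centre) (u - centre)}"
proof -
  define q where "q = y - centre"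
  note q = r(2)[folded q_def] norm_le_1_unit_square[OF y, folded q_def]
  have meas: "{u. region r q (u - centre)} \<in> sets lborel"
    using sets_region by (simp add: q_def)
  show ?thesis
  proof (cases "\<bar>snd q\<bar> \<le> \<bar>fst q\<bar>")
    case True
    from sliver_strip[OF True r(1) q] obtain lo hi where
      *: "lo \<le> hi" "r ^ 5 / 256 \<le> (hi - lo) * (2 * (r ^ 3 / 32))"
      "\<And>p. fst p \<in> {lo..hi} \<Longrightarrow> snd p \<in> {fst p / fst q * snd q - r ^ 3 / 32..fst p / fst q * snd q + r ^ 3 / 32} \<Longrightarrow> sliver r q p"
      by metis
    \<comment> \<open>\<open>g\<close> is the midline of the strip in the original coordinates; both
      axes are shifted by \<open>1/2\<close>.\<close>
    define g where "g x = 1/2 + (x - 1/2) / fst q * snd q" for x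
    have [measurable]: "g \<in> borel_measurable borel" unfolding g_def by measurable
    have "ennreal (r ^ 5 / 256) \<le> ennreal ((hi + 1/2 - (lo + 1/2)) * (2 * (r ^ 3 / 32)))"
      using *(2) by (intro ennreal_leI) simp
    also have "\<dots> = emeasure lborel {u. fst u \<in> {lo + 1/2..hi + 1/2} \<and>
        snd u \<in> {g (fst u) - r ^ 3 / 32..g (fst u) + r ^ 3 / 32}}"
      using * r by (intro emeasure_strip(1)[symmetric]) auto
    also have "\<dots> \<le> emeasure lborel {u. region r q (u - centre)}"
    proof (intro emeasure_mono meas subsetI CollectI)
      fix u assume "u \<in> {u. fst u \<in> {lo + 1/2..hi + 1/2} \<and>
        snd u \<in> {g (fst u) - r ^ 3 / 32..g (fst u) + r ^ 3 / 32}}"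
      then have "fst (u - centre) \<in> {lo..hi}"
        "snd (u - centre) \<in> {fst (u - centre) / fst q * snd q - r ^ 3 / 32..fst (u - centre) / fst q * snd q + r ^ 3 / 32}"
        unfolding mem_Collect_eq atLeastAtMost_iff g_def fst_diff snd_diff fst_conv snd_conv by linarith+
      then show "region r q (u - centre)" using *(3) True unfolding region_def by presburger
    qed
    finally show ?thesis by (simp add: q_def)
  next
    case False
    define q' where "q' = prod.swap q"
    have q': "\<bar>snd q'\<bar> \<le> \<bar>fst q'\<bar>" "r / 2 \<le> norm q'" "norm q' \<le> 1"
      using False q by (auto simp: q'_def norm_prod_swap)
    from sliver_strip[OF q'(1) r(1) q'(2,3)] obtain lo hi where
      *: "lo \<le> hi" "r ^ 5 / 256 \<le> (hi - lo) * (2 * (r ^ 3 / 32))"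
      "\<And>p. fst p \<in> {lo..hi} \<Longrightarrow> snd p \<in> {fst p / fst q' * snd q' - r ^ 3 / 32..fst p / fst q' * snd q' + r ^ 3 / 32} \<Longrightarrow> sliver r q' p"
      by metis
    define g where "g x = 1/2 + (x - 1/2) / fst q' * snd q'" for x
    have [measurable]: "g \<in> borel_measurable borel" unfolding g_def by measurable
    have "ennreal (r ^ 5 / 256) \<le> ennreal ((hi + 1/2 - (lo + 1/2)) * (2 * (r ^ 3 / 32)))"
      using *(2) by (intro ennreal_leI) simp
    also have "\<dots> = emeasure lborel {u. snd u \<in> {lo + 1/2..hi + 1/2} \<and>
        fst u \<in> {g (snd u) - r ^ 3 / 32..g (snd u) + r ^ 3 / 32}}"
      using * r by (intro emeasure_strip(2)[symmetric]) auto
    also have "\<dots> \<le> emeasure lborel {u. region r q (u - centre)}"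
    proof (intro emeasure_mono meas subsetI CollectI)
      fix u :: "real \<times> real"
      define p where "p = prod.swap (u - centre)"
      have p: "fst p = snd u - 1/2" "snd p = fst u - 1/2" by (simp_all add: p_def)
      assume "u \<in> {u. snd u \<in> {lo + 1/2..hi + 1/2} \<and>
        fst u \<in> {g (snd u) - r ^ 3 / 32..g (snd u) + r ^ 3 / 32}}"
      then have "fst p \<in> {lo..hi}"
        "snd p \<in> {fst p / fst q' * snd q' - r ^ 3 / 32..fst p / fst q' * snd q' + r ^ 3 / 32}"
        unfolding mem_Collect_eq atLeastAtMost_iff g_def p by linarith+
      then have "sliver r q' p" using *(3) by blast
      then show "region r q (u - centre)" using False unfolding region_def p_def q'_def by presburger
    qed
    finally show ?thesis by (simp add: q_def)
  qed
qed

section \<open>Probability estimates for uniform points\<close>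

lemma emeasure_unit_square: "emeasure lborel unit_square = 1"
proof -
  have "unit_square = cbox 0 1 \<times> cbox 0 1" by (simp add: cbox_Pair_eq)
  then show ?thesis
    unfolding lborel_prod[symmetric] by (simp add: lborel.emeasure_pair_measure_Times)
qed

abbreviation unif :: "(real \<times> real) measure" where
  "unif \<equiv> uniform_measure lborel unit_square"

lemma prob_space_unif: "prob_space unif"
  by (rule prob_space_uniform_measure) (simp_all add: emeasure_unit_square)

lemma prob_space_rgg_space: "prob_space (rgg_space n)"
  unfolding rgg_space_def using prob_space_unif by (intro prob_space_PiM)

text \<open>The region lies inside the square, which has area 1, so its probability is its
  area.\<close>

lemma measure_unif_region:
  assumes y: "y \<in> unit_square" and r: "0 < r" "r / 2 \<le> norm (y - centre)"
  shows "r ^ 5 / 256 \<le> measure unif {u. region r (y - centre) (u - centre)}"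
proof -
  interpret prob_space unif by (rule prob_space_unif)
  let ?S = "{u. region r (y - centre) (u - centre)}"
  have "?S \<in> sets lborel" using sets_region by simp
  moreover have "unit_square \<inter> ?S = ?S"
    using region_subset_unit_square[OF y r] by blast
  ultimately have "emeasure unif ?S = emeasure lborel ?S"
    by (simp add: emeasure_unit_square divide_ennreal_def)
  then have "ennreal (r ^ 5 / 256) \<le> ennreal (measure unif ?S)"
    using emeasure_region[OF assms] by (simp add: emeasure_eq_measure)
  then show ?thesis by simp
qed

text \<open>Given \<open>x i = y\<close>, the other points are independent and each avoids the
  section of \<open>A\<close> at \<open>y\<close> with probability at most \<open>1 - a\<close>. The
  bound on sections is asked only almost everywhere because in the application it can fail outside
  the unit square.\<close>

lemma (in prob_space) measure_PiM_no_neighbour_le: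
  assumes I: "finite I" "i \<notin> I" and A[measurable]: "A \<in> sets (M \<Otimes>\<^sub>M M)"
    and a: "AE y in M. a \<le> measure M {z \<in> space M. (y, z) \<in> A}" "0 \<le> a" "a \<le> 1"
  shows "{x \<in> space (PiM (insert i I) (\<lambda>_. M)). \<forall>j\<in>I. (x i, x j) \<notin> A} \<in> sets (PiM (insert i I) (\<lambda>_. M))"
      (is "?E \<in> sets ?P")
    and "measure (PiM (insert i I) (\<lambda>_. M)) {x \<in> space (PiM (insert i I) (\<lambda>_. M)). \<forall>j\<in>I. (x i, x j) \<notin> A}
      \<le> (1 - a) ^ card I"
proof -
  interpret S: product_sigma_finite "\<lambda>_. M"
    by (simp add: product_sigma_finite_def sigma_finite_measure_axioms)
  interpret P: prob_space ?P
    by (intro prob_space_PiM prob_space_axioms)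
  show E[measurable]: "?E \<in> sets ?P"
    using I(1) by measurable
  have "emeasure ?P ?E = (\<integral>\<^sup>+x. indicator ?E x \<partial>?P)" by simp
  \<comment> \<open>Fubini with the point \<open>i\<close> in the outer integral.\<close>
  also have "\<dots> = (\<integral>\<^sup>+y. (\<integral>\<^sup>+x. indicator ?E (x(i := y)) \<partial>PiM I (\<lambda>_. M)) \<partial>M)"
    by (rule S.product_nn_integral_insert_rev[OF I]) measurable
  also have "\<dots> \<le> (\<integral>\<^sup>+y. ennreal ((1 - a) ^ card I) \<partial>M)"
  proof (rule nn_integral_mono_AE)
    show "AE y in M. (\<integral>\<^sup>+x. indicator ?E (x(i := y)) \<partial>PiM I (\<lambda>_. M)) \<le> ennreal ((1 - a) ^ card I)"
      using a(1) AE_space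
    proof eventually_elim
      case (elim y)
      let ?B = "{z \<in> space M. (y, z) \<notin> A}"
      have [measurable]: "{z \<in> space M. (y, z) \<in> A} \<in> sets M" and B[measurable]: "?B \<in> sets M"
        using elim(2) by measurable
      have "(\<integral>\<^sup>+x. indicator ?E (x(i := y)) \<partial>PiM I (\<lambda>_. M)) =
          (\<integral>\<^sup>+x. indicator (PiE I (\<lambda>_. ?B)) x \<partial>PiM I (\<lambda>_. M))"
      proof (rule nn_integral_cong)
        fix x assume x: "x \<in> space (PiM I (\<lambda>_. M))"
        then have "x(i := y) \<in> space ?P"
          using elim(2) I by (auto simp: space_PiM PiE_def extensional_def)
        then have "x(i := y) \<in> ?E \<longleftrightarrow> x \<in> PiE I (\<lambda>_. ?B)"
          using x I(2) by (auto simp: space_PiM PiE_iff)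
        then show "indicator ?E (x(i := y)) = (indicator (PiE I (\<lambda>_. ?B)) x :: ennreal)"
          by (simp add: indicator_def)
      qed
      also have "\<dots> = emeasure (PiM I (\<lambda>_. M)) (PiE I (\<lambda>_. ?B))"
        using I(1) by (intro nn_integral_indicator sets_PiM_I_finite) auto
      also have "\<dots> = (\<Prod>j\<in>I. emeasure M ?B)"
        using I(1) by (intro S.emeasure_PiM) auto
      also have "\<dots> = ennreal (measure M ?B ^ card I)"
        by (simp add: emeasure_eq_measure ennreal_power)
      also have "\<dots> \<le> ennreal ((1 - a) ^ card I)"
      proof (intro ennreal_leI power_mono)
        have "?B = space M - {z \<in> space M. (y, z) \<in> A}" by auto
        then show "measure M ?B \<le> 1 - a" using elim(1) by (simp add: prob_compl)
      qed simp
      finally show ?case .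
    qed
  qed
  also have "\<dots> = ennreal ((1 - a) ^ card I)" by (simp add: emeasure_space_1)
  finally show "measure ?P ?E \<le> (1 - a) ^ card I"
    using a by (simp add: P.emeasure_eq_measure)
qed

lemma sets_rgg_adj:
  "{x \<in> space (rgg_space n). P (rgg_adj n x r)} \<in> sets (rgg_space n)"
proof -
  let ?Q = "{0..<n} \<times> {0..<n}"
  have M: "(\<lambda>x. rgg_adj n x r i j) \<in> rgg_space n \<rightarrow>\<^sub>M count_space UNIV" for i j
  proof (cases "i < n \<and> j < n")
    case True
    have "rgg_space n \<rightarrow>\<^sub>M unif = rgg_space n \<rightarrow>\<^sub>M borel"
      by (rule measurable_cong_sets) simp_all
    with True have "(\<lambda>x. x i) \<in> rgg_space n \<rightarrow>\<^sub>M borel" "(\<lambda>x. x j) \<in> rgg_space n \<rightarrow>\<^sub>M borel"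
      using measurable_component_singleton[of _ "{0..<n}" "\<lambda>_. unif"]
      unfolding rgg_space_def by auto
    then have "(\<lambda>x. dist (x i) (x j)) \<in> borel_measurable (rgg_space n)"
      by (rule borel_measurable_dist)
    then show ?thesis
      unfolding rgg_adj_def by measurable
  next
    case False
    then have "rgg_adj n x r i j \<longleftrightarrow> False" for x unfolding rgg_adj_def by blast
    then show ?thesis by simp
  qed
  \<comment> \<open>P need not be measurable in any sense: the graph takes only finitely many values.\<close>
  have eq: "{x \<in> space (rgg_space n). P (rgg_adj n x r)} =
    (\<Union>S\<in>{S \<in> Pow ?Q. P (\<lambda>i j. (i, j) \<in> S)}.
      {x \<in> space (rgg_space n). \<forall>p\<in>?Q. rgg_adj n x r (fst p) (snd p) \<longleftrightarrow> p \<in> S})" (is "?L = ?R")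
  proof (intro subset_antisym subsetI)
    fix x assume x: "x \<in> ?L"
    let ?S = "{(i, j). rgg_adj n x r i j}"
    have "?S \<subseteq> ?Q" unfolding rgg_adj_def by fastforce
    then have "?S \<in> {S \<in> Pow ?Q. P (\<lambda>i j. (i, j) \<in> S)}"
      using x by simp
    moreover have "x \<in> {x \<in> space (rgg_space n). \<forall>p\<in>?Q. rgg_adj n x r (fst p) (snd p) \<longleftrightarrow> p \<in> ?S}"
      using x by auto
    ultimately show "x \<in> ?R" by blast
  next
    fix x assume "x \<in> ?R"
    then obtain S where S: "S \<subseteq> ?Q" "P (\<lambda>i j. (i, j) \<in> S)" "x \<in> space (rgg_space n)"
      "\<And>p. p \<in> ?Q \<Longrightarrow> rgg_adj n x r (fst p) (snd p) \<longleftrightarrow> p \<in> S" by blast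
    have "rgg_adj n x r i j \<longleftrightarrow> (i, j) \<in> S" for i j
    proof (cases "(i, j) \<in> ?Q")
      case True
      then show ?thesis using S(4)[of "(i, j)"] by simp
    next
      case False
      then show ?thesis using S(1) by (auto simp: rgg_adj_def)
    qed
    then have "rgg_adj n x r = (\<lambda>i j. (i, j) \<in> S)" by blast
    then show "x \<in> ?L" using S(2,3) by simp
  qed
  have "{x \<in> space (rgg_space n). \<forall>p\<in>?Q. rgg_adj n x r (fst p) (snd p) \<longleftrightarrow> p \<in> S} \<in> sets (rgg_space n)" for S
  proof (rule sets.sets_Collect_finite_All)
    show "{x \<in> space (rgg_space n). rgg_adj n x r (fst p) (snd p) \<longleftrightarrow> p \<in> S} \<in> sets (rgg_space n)" for p
      using M[of "fst p" "snd p"] sets.sets_Collect_neg by (cases "p \<in> S") (simp_all add: pred_def)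
  qed simp
  then show ?thesis
    unfolding eq by (intro sets.finite_UN) auto
qed

text \<open>Union bound over the \<open>n\<close> events that vertex \<open>i\<close> finds no other
  vertex in its region. As \<open>r\<close> has no upper bound, \<open>r ^ 5 / 256\<close> may
  exceed 1; hence the separate parameter \<open>a\<close>.\<close>

lemma rgg_cop_number_prob_ge:
  assumes n: "2 \<le> n" and r: "0 < r" and a: "0 \<le> a" "a \<le> 1" "a \<le> r ^ 5 / 256"
  shows "1 - real n * (1 - a) ^ (n - 1) \<le>
    measure (rgg_space n) {x \<in> space (rgg_space n). cop_number {0..<n} (rgg_adj n x r) = 1}"
proof -
  interpret U: prob_space unif by (rule prob_space_unif)
  interpret G: prob_space "rgg_space n" by (rule prob_space_rgg_space)
  \<comment> \<open>A point near the centre accepts every partner and a point outside the square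
    accepts none, so all points lie in the square whenever no \<open>bad i\<close> occurs.\<close>
  define A where "A = {z :: (real \<times> real) \<times> (real \<times> real). fst z \<in> unit_square \<and>
    (norm (fst z - centre) < r / 2 \<or> region r (fst z - centre) (snd z - centre))}"
  have "A \<in> sets (borel \<Otimes>\<^sub>M borel)"
  proof -
    have [measurable]: "unit_square \<in> sets borel" by simp
    have "Measurable.pred (borel \<Otimes>\<^sub>M borel) (\<lambda>z :: (real \<times> real) \<times> (real \<times> real). fst z \<in> unit_square \<and>
      (norm (fst z - centre) < r / 2 \<or> region r (fst z - centre) (snd z - centre)))"
      by measurable
    then show ?thesis by (simp add: A_def pred_def space_pair_measure)
  qed
  moreover have "sets (unif \<Otimes>\<^sub>M unif) = sets (borel \<Otimes>\<^sub>M borel)"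
    by (intro sets_pair_measure_cong) simp_all
  ultimately have A: "A \<in> sets (unif \<Otimes>\<^sub>M unif)" by simp
  have AE: "AE y in unif. a \<le> measure unif {z \<in> space unif. (y, z) \<in> A}"
  proof (rule AE_uniform_measureI)
    show "AE y in lborel. y \<in> unit_square \<longrightarrow> a \<le> measure unif {z \<in> space unif. (y, z) \<in> A}"
    proof (intro AE_I2 impI)
      fix y assume y: "y \<in> unit_square"
      show "a \<le> measure unif {z \<in> space unif. (y, z) \<in> A}"
      proof (cases "norm (y - centre) < r / 2")
        case True
        then have "{z \<in> space unif. (y, z) \<in> A} = space unif" using y by (simp add: A_def)
        then show ?thesis using a U.prob_space by simp
      next
        case False
        then have "{z \<in> space unif. (y, z) \<in> A} = {u. region r (y - centre) (u - centre)}"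
          using y by (simp add: A_def)
        then show ?thesis using measure_unif_region[OF y r] False a(3) by simp
      qed
    qed
  qed simp
  \<comment> \<open>Without \<open>i\<close> itself, the \<open>n - 1\<close> partners are
    independent of \<open>x i\<close>.\<close>
  define bad where "bad i = {x \<in> space (rgg_space n). \<forall>j\<in>{0..<n} - {i}. (x i, x j) \<notin> A}" for i
  have bad: "bad i \<in> sets (rgg_space n)" "measure (rgg_space n) (bad i) \<le> (1 - a) ^ (n - 1)"
    if "i < n" for i
    using U.measure_PiM_no_neighbour_le[OF _ _ A AE a(1,2), of "{0..<n} - {i}" i] that
    by (simp_all add: bad_def rgg_space_def insert_absorb)
  let ?good = "{x \<in> space (rgg_space n). cop_number {0..<n} (rgg_adj n x r) = 1}"
  have good: "?good \<in> sets (rgg_space n)" by (rule sets_rgg_adj)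
  have cover: "space (rgg_space n) - ?good \<subseteq> (\<Union>i\<in>{0..<n}. bad i)"
  proof
    fix x assume x: "x \<in> space (rgg_space n) - ?good"
    show "x \<in> (\<Union>i\<in>{0..<n}. bad i)"
    proof (rule ccontr)
      assume "x \<notin> (\<Union>i\<in>{0..<n}. bad i)"
      then have "\<exists>j<n. (x i, x j) \<in> A" if "i < n" for i
        using x that by (force simp: bad_def)
      then have "cop_number {0..<n} (rgg_adj n x r) = 1"
        using n r by (intro rgg_cop_number_eq_1) (fastforce simp: A_def)+
      then show False using x by simp
    qed
  qed
  have "1 - measure (rgg_space n) ?good = measure (rgg_space n) (space (rgg_space n) - ?good)"
    by (rule G.prob_compl[OF good, symmetric])
  also have "\<dots> \<le> measure (rgg_space n) (\<Union>i\<in>{0..<n}. bad i)"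
    using bad by (intro G.finite_measure_mono cover sets.finite_UN) auto
  also have "\<dots> \<le> (\<Sum>i\<in>{0..<n}. measure (rgg_space n) (bad i))"
    using bad by (intro G.finite_measure_subadditive_finite) auto
  also have "\<dots> \<le> (\<Sum>i\<in>{0..<n}. (1 - a) ^ (n - 1))"
    using bad by (intro sum_mono) auto
  also have "\<dots> = real n * (1 - a) ^ (n - 1)" by simp
  finally show ?thesis by simp
qed

section \<open>Choice of the constant and passage to the limit\<close>

theorem theorem5:
  shows "\<exists>K2 > 0. \<forall>r :: nat \<Rightarrow> real.
     (\<forall>\<^sub>F n in sequentially. r n \<ge> K2 * (ln (real n) / real n) powr (1/5)) \<longrightarrow>
     ((\<lambda>n. measure (rgg_space n)
        {x \<in> space (rgg_space n). cop_number {0..<n} (rgg_adj n x (r n)) = 1})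
      \<longlonglongrightarrow> 1)"
proof (intro exI[of _ 4] conjI allI impI)
  fix r :: "nat \<Rightarrow> real"
  assume r: "\<forall>\<^sub>F n in sequentially. r n \<ge> 4 * (ln (real n) / real n) powr (1/5)"
  let ?p = "\<lambda>n. measure (rgg_space n) {x \<in> space (rgg_space n). cop_number {0..<n} (rgg_adj n x (r n)) = 1}"
  \<comment> \<open>\<open>4 * (ln n / n)\<close> will serve as the parameter \<open>a\<close>,
    which has to be at most 1.\<close>
  have "(\<lambda>n. 4 * (ln (real n) / real n)) \<longlonglongrightarrow> 4 * 0"
    by (intro tendsto_intros lim_ln_over_n)
  then have small: "\<forall>\<^sub>F n in sequentially. 4 * (ln (real n) / real n) < 1"
    by (rule order_tendstoD) simp
  have "\<forall>\<^sub>F n in sequentially. 1 - 1 / real n \<le> ?p n"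
    using r small eventually_ge_at_top[of 2]
  proof eventually_elim
    case (elim n)
    define s where "s = ln (real n) / real n"
    have s: "0 < s" "4 * s < 1" "4 * s powr (1/5) \<le> r n"
      using elim by (auto simp: s_def)
    \<comment> \<open>The constant 4 satisfies \<open>4 ^ 5 / 256 = 4\<close>, so
      \<open>4 * s\<close> qualifies as \<open>a\<close>.\<close>
    have "(4 * s powr (1/5)) ^ 5 = 1024 * s"
      using s by (simp add: power_mult_distrib powr_power)
    moreover have "(4 * s powr (1/5)) ^ 5 \<le> r n ^ 5"
      using s by (intro power_mono) auto
    ultimately have a: "4 * s \<le> r n ^ 5 / 256" by simp
    have "(0::real) < 4 * s powr (1/5)" using s by simp
    then have rn: "0 < r n" using s by linarith
    have "(1 - 4 * s) ^ (n - 1) \<le> exp (- (4 * s)) ^ (n - 1)"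
      using s exp_ge_add_one_self[of "- (4 * s)"] by (intro power_mono) auto
    also have "\<dots> = exp (- (4 * s) * real (n - 1))"
      by (rule exp_of_nat2_mult[symmetric])
    also have "\<dots> \<le> exp (- 2 * ln (real n))"
    proof -
      \<comment> \<open>Half of the factor 4 is spent on replacing \<open>n - 1\<close> by
        \<open>n / 2\<close>. What remains gives \<open>1 / n^2\<close>, enough to beat the
        \<open>n\<close> events of the union bound.\<close>
      have "real n / 2 \<le> real (n - 1)" using elim by (simp add: of_nat_diff)
      then have "4 * s * (real n / 2) \<le> 4 * s * real (n - 1)" using s by (intro mult_left_mono) auto
      moreover have "4 * s * (real n / 2) = 2 * ln (real n)" using elim by (simp add: s_def)
      ultimately show ?thesis by simp
    qed
    also have "\<dots> = 1 / (real n)\<^sup>2"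
    proof -
      have "exp (- 2 * ln (real n)) = inverse (exp (ln (real n)) ^ 2)"
        by (simp add: exp_minus exp_double)
      then show ?thesis using elim by (simp add: inverse_eq_divide)
    qed
    finally have "real n * (1 - 4 * s) ^ (n - 1) \<le> real n * (1 / (real n)\<^sup>2)"
      by (intro mult_left_mono) auto
    also have "\<dots> = 1 / real n" using elim by (simp add: power2_eq_square)
    finally show ?case
      using rgg_cop_number_prob_ge[OF _ rn _ _ a, of n] s elim by simp
  qed
  moreover have "\<forall>\<^sub>F n in sequentially. ?p n \<le> 1"
    by (intro always_eventually allI prob_space.prob_le_1 prob_space_rgg_space)
  moreover have "(\<lambda>n. 1 - 1 / real n) \<longlonglongrightarrow> 1"
    using tendsto_diff[OF tendsto_const lim_1_over_n, of 1] by simp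
  ultimately show "?p \<longlonglongrightarrow> 1"
    by (rule tendsto_sandwich[OF _ _ _ tendsto_const])
qed simp

end
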